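(* Let $\mathbb{k}$ be a field and let $q\in\mathbb{k}^*$, $q\neq1$, be a root of unity. Then $\mathcal{H}'_q$ is a PI algebra if and only if $\operatorname{ch}(\mathbb{k})>0$.
   Context: $\mathcal{H}'_q$ is the associative $\mathbb{k}$-algebra generated by $x,y,z$ subject to the relations $zx=qxz$, $zy=q^{-1}yz$, $yx-qxy=z$. $\operatorname{ch}(\mathbb{k})$ is the characteristic of $\mathbb{k}$. A PI (polynomial identity) algebra is one satisfying a monic polynomial identity, i.e. there is a polynomial in noncommuting variables with integer coefficients, with some monomial of highest degree having coefficient $1$, that vanishes on all tuples of elements of the algebra. *)

theory Defs
  imports "HOL-Library.Poly_Mapping" "HOL-Algebra.Algebra"
    "HOL-Algebra.Algebraic_Closure_Type"
begin

text \<open>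
  Lists under concatenation are the free monoid, so with the following instance the convolution
  product of \<^theory>\<open>HOL-Library.Poly_Mapping\<close> turns \<open>'v list \<Rightarrow>\<^sub>0 'a\<close> into the free associative
  unital algebra over \<open>'a\<close> on the set of generators \<open>'v\<close>.
\<close>

instantiation list :: (type) monoid_add
begin

definition zero_list :: "'a list" where
  "0 = []"

definition plus_list :: "'a list \<Rightarrow> 'a list \<Rightarrow> 'a list" where
  "u + v = u @ v"

instance
  by standard (simp_all add: zero_list_def plus_list_def)

end

type_synonym ('v, 'a) free_alg = "'v list \<Rightarrow>\<^sub>0 'a"

definition free_var :: "'v \<Rightarrow> ('v, 'a::zero_neq_one) free_alg" where
  "free_var v = Poly_Mapping.single [v] 1"

definition free_const :: "'a::zero \<Rightarrow> ('v, 'a) free_alg" where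
  "free_const c = Poly_Mapping.single [] c"

definition word_eval :: "('r, 'm) ring_scheme \<Rightarrow> ('v \<Rightarrow> 'r) \<Rightarrow> 'v list \<Rightarrow> 'r" where
  "word_eval R s w = foldr (\<lambda>v a. s v \<otimes>\<^bsub>R\<^esub> a) w \<one>\<^bsub>R\<^esub>"

definition free_eval :: "('r, 'm) ring_scheme \<Rightarrow> ('v \<Rightarrow> 'r) \<Rightarrow> ('v, int) free_alg \<Rightarrow> 'r" where
  "free_eval R s f =
     (\<Oplus>\<^bsub>R\<^esub>w \<in> Poly_Mapping.keys f. [Poly_Mapping.lookup f w] \<cdot>\<^bsub>R\<^esub> word_eval R s w)"

definition monic_free :: "('v, int) free_alg \<Rightarrow> bool" where
  "monic_free f \<longleftrightarrow>
     (\<exists>w \<in> Poly_Mapping.keys f. Poly_Mapping.lookup f w = 1 \<and>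
        (\<forall>u \<in> Poly_Mapping.keys f. length u \<le> length w))"

text \<open>
  The variables are indexed by \<^typ>\<open>nat\<close>; each polynomial involves only finitely many of them.
  Identities have integer coefficients, so only the underlying ring of an algebra matters.
\<close>

definition PI_ring :: "('r, 'm) ring_scheme \<Rightarrow> bool" where
  "PI_ring R \<longleftrightarrow>
     (\<exists>f :: (nat, int) free_alg. monic_free f \<and>
        (\<forall>s. (\<forall>i. s i \<in> carrier R) \<longrightarrow> free_eval R s f = \<zero>\<^bsub>R\<^esub>))"

datatype gen = Gx | Gy | Gz

definition Hq_relations :: "'a::field \<Rightarrow> (gen, 'a) free_alg set" where
  "Hq_relations q =
     (let x = free_var Gx; y = free_var Gy; z = free_var Gz in
       {z * x - free_const q * x * z,
        z * y - free_const (inverse q) * y * z,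
        y * x - free_const q * x * y - z})"

lemma ring_of_type_algebra_ring: "ring (ring_of_type_algebra :: 'a::ring_1 ring)"
proof -
  have "\<exists>y. x + y = 0" for x :: 'a
    using add.right_inverse by blast
  then show ?thesis
    unfolding ring_of_type_algebra_def using add.right_inverse
    by unfold_locales (auto simp: algebra_simps Units_def)
qed

text \<open>
  \<^const>\<open>ideal\<close> means two-sided ideal. Since scalars are elements of the free algebra, the ideal
  below is a subspace, and the quotient ring is the quotient algebra.
\<close>

definition Hq :: "'a::field \<Rightarrow> (gen, 'a) free_alg set ring" where
  "Hq q = (let F = ring_of_type_algebra in F Quot (Idl\<^bsub>F\<^esub> (Hq_relations q)))"

end

theory Submission
  imports Defs
begin

text \<open>
  In characteristic $0$ let the algebra act on power series in $t$, with $x$ acting as multiplication by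
  $t$ and $z$, $y$ sending $f(t)$ to $f(qt)$, $f'(qt)$. If $q^n = 1$, then $q\,x\,y\,z^{n-1}$ acts as $t\,d/dt$,
  whose eigenvalues $0, 1, 2, \dots$ are distinct. By interpolation, polynomials in it multiply
  $1, t, \dots, t^{d-1}$ by arbitrary prescribed scalars. Following them by $x$ yields substitutions under which a
  single chosen word of length $d$ moves $1$ to $t^d$, so no monic polynomial is an identity.

  In characteristic $p > 0$ put $N = pn$. The powers $x^N$, $y^N$, $z^N$ are central because
  $y x^i = q^i x^i y + i q^{i-1} x^{i-1} z$ and $y^i x = q^i x y^i + i y^{i-1} z$. Hence the monomials $x^i y^j z^k$ with
  exponents below $N$ span the algebra over its centre, and the standard polynomial in more than
  $N^3$ variables, being multilinear and alternating, vanishes.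
\<close>

subsection \<open>Identities of quotients of a ring\<close>

text \<open>Evaluation upstairs, in the ring before factoring: it lets all later arguments handle
  representatives and ideal membership instead of cosets.\<close>

definition poly_value :: "(nat \<Rightarrow> 'a::ring_1) \<Rightarrow> (nat, int) free_alg \<Rightarrow> 'a" where
  "poly_value s f =
     (\<Sum>w\<in>Poly_Mapping.keys f. of_int (Poly_Mapping.lookup f w) * prod_list (map s w))"

lemma ring_of_type_algebra_simps [simp]:
  "carrier ring_of_type_algebra = UNIV" "a \<otimes>\<^bsub>ring_of_type_algebra\<^esub> b = a * b"
  "a \<oplus>\<^bsub>ring_of_type_algebra\<^esub> b = a + b" "\<one>\<^bsub>ring_of_type_algebra\<^esub> = 1" "\<zero>\<^bsub>ring_of_type_algebra\<^esub> = 0"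
  by (simp_all add: ring_of_type_algebra_def)

lemma a_inv_ring_of_type_algebra: "\<ominus>\<^bsub>ring_of_type_algebra\<^esub> a = - (a :: 'a::ring_1)"
proof -
  interpret ring "ring_of_type_algebra :: 'a ring"
    by (rule ring_of_type_algebra_ring)
  show ?thesis
    by (rule minus_equality) simp_all
qed

lemma ideal_ring_of_type_algebraI:
  fixes I :: "'a::ring_1 set"
  assumes "0 \<in> I" "\<And>a b. a \<in> I \<Longrightarrow> b \<in> I \<Longrightarrow> a + b \<in> I" 
    "\<And>a b. a \<in> I \<Longrightarrow> b * a \<in> I" "\<And>a b. a \<in> I \<Longrightarrow> a * b \<in> I"
  shows "ideal I ring_of_type_algebra"
proof (rule idealI)
  show "subgroup I (add_monoid ring_of_type_algebra)"
  proof (rule subgroup.intro)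
    fix a assume "a \<in> I"
    then have "\<ominus>\<^bsub>ring_of_type_algebra\<^esub> a \<in> I"
      using assms(3)[of a "- 1"] by (simp add: a_inv_ring_of_type_algebra)
    then show "inv\<^bsub>add_monoid ring_of_type_algebra\<^esub> a \<in> I"
      by (simp only: a_inv_def)
  qed (simp_all add: assms)
qed (simp_all add: assms ring_of_type_algebra_ring)

context
  fixes F :: "'a::ring_1 ring" and I :: "'a set"
  assumes F: "F = ring_of_type_algebra" and I: "ideal I F"
begin

interpretation ideal I F by (rule I)

private lemma F_simps [simp]:
  "carrier F = UNIV" "x \<otimes>\<^bsub>F\<^esub> y = x * y" "x \<oplus>\<^bsub>F\<^esub> y = x + y" "\<one>\<^bsub>F\<^esub> = 1" "\<zero>\<^bsub>F\<^esub> = 0"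
  "\<ominus>\<^bsub>F\<^esub> x = - x"
  by (simp_all add: F a_inv_ring_of_type_algebra)

private abbreviation Q where "Q \<equiv> F Quot I"
private abbreviation cls where "cls a \<equiv> I +>\<^bsub>F\<^esub> a"

interpretation Q: ring Q by (rule quotient_is_ring)

interpretation cls: ring_hom_ring F Q "\<lambda>a. cls a"
  by (rule rcos_ring_hom_ring)

lemma cls_eq_zero_iff: "cls a = \<zero>\<^bsub>Q\<^esub> \<longleftrightarrow> a \<in> I"
  by (metis FactRing_def F_simps(1) UNIV_I a_rcos_const rcos_const_imp_mem ring_record_simps(11))

lemma cls_word: "word_eval Q (\<lambda>i. cls (s i)) w = cls (prod_list (map s w))"
proof (induction w)
  case Nil
  show ?case using cls.hom_one by (simp add: word_eval_def)
next
  case (Cons v w)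
  have "cls (s v * prod_list (map s w)) = cls (s v) \<otimes>\<^bsub>Q\<^esub> cls (prod_list (map s w))"
    using cls.hom_mult[of "s v" "prod_list (map s w)"] by simp
  then show ?case using Cons by (simp add: word_eval_def)
qed

lemma cls_add_pow_nat: "[k] \<cdot>\<^bsub>Q\<^esub> cls a = cls (of_nat k * a)" for k :: nat
proof (induction k)
  case 0
  show ?case using cls.hom_zero by simp
next
  case (Suc k)
  have "cls (of_nat k * a + a) = cls (of_nat k * a) \<oplus>\<^bsub>Q\<^esub> cls a"
    using cls.hom_add[of "of_nat k * a" a] by simp
  then show ?case using Suc by (simp add: algebra_simps)
qed

lemma cls_add_pow_int: "[k] \<cdot>\<^bsub>Q\<^esub> cls a = cls (of_int k * a)" for k :: int
proof (cases "k \<ge> 0")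
  case True
  then show ?thesis
    using cls_add_pow_nat[of "nat k" a] by (simp add: add_pow_int_ge)
next
  case False
  have "cls (- (of_nat (nat (- k)) * a)) = \<ominus>\<^bsub>Q\<^esub> cls (of_nat (nat (- k)) * a)"
    using cls.hom_a_inv[of "of_nat (nat (- k)) * a"] by simp
  with False show ?thesis
    using cls_add_pow_nat[of "nat (- k)" a] by (simp add: add_pow_int_lt)
qed

lemma cls_finsum:
  "finite A \<Longrightarrow> (\<Oplus>\<^bsub>Q\<^esub>w\<in>A. cls (g w)) = cls (\<Sum>w\<in>A. g w)"
proof (induction A rule: finite_induct)
  case empty
  show ?case using cls.hom_zero by simp
next
  case (insert w A)
  have "cls (g w + (\<Sum>w\<in>A. g w)) = cls (g w) \<oplus>\<^bsub>Q\<^esub> cls (\<Sum>w\<in>A. g w)"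
    using cls.hom_add[of "g w" "\<Sum>w\<in>A. g w"] by simp
  moreover have "cls a \<in> carrier Q" for a
    using cls.hom_closed[of a] by simp
  ultimately show ?case using insert by (simp add: Q.finsum_insert)
qed

lemma free_eval_cls: "free_eval Q (\<lambda>i. cls (s i)) f = cls (poly_value s f)"
  by (simp add: free_eval_def poly_value_def cls_word cls_add_pow_int cls_finsum)

text \<open>Every substitution into the quotient lifts to representatives, and evaluation commutes
  with the quotient map, so an identity of the quotient is a polynomial whose values upstairs all
  lie in \<open>I\<close>.\<close>

lemma PI_ring_quotient_iff:
  "PI_ring Q \<longleftrightarrow> (\<exists>f. monic_free f \<and> (\<forall>s. poly_value s f \<in> I))"
proof -
  have "(\<forall>t. (\<forall>i. t i \<in> carrier Q) \<longrightarrow> free_eval Q t f = \<zero>\<^bsub>Q\<^esub>) \<longleftrightarrow> (\<forall>s. poly_value s f \<in> I)"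
    for f
  proof (intro iffI allI impI)
    fix s :: "nat \<Rightarrow> 'a"
    assume *: "\<forall>t. (\<forall>i. t i \<in> carrier Q) \<longrightarrow> free_eval Q t f = \<zero>\<^bsub>Q\<^esub>"
    have "cls (s i) \<in> carrier Q" for i
      using cls.hom_closed[of "s i"] by simp
    then have "free_eval Q (\<lambda>i. cls (s i)) f = \<zero>\<^bsub>Q\<^esub>"
      using *[rule_format, of "\<lambda>i. cls (s i)"] by simp
    then show "poly_value s f \<in> I"
      by (simp add: free_eval_cls cls_eq_zero_iff)
  next
    fix t :: "nat \<Rightarrow> 'a set"
    assume *: "\<forall>s. poly_value s f \<in> I" and t: "\<forall>i. t i \<in> carrier Q"
    have "\<exists>a. t i = cls a" for i
      using t[rule_format, of i] by (auto simp: FactRing_def A_RCOSETS_def')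
    then obtain s where "t = (\<lambda>i. cls (s i))"
      by metis
    with * show "free_eval Q t f = \<zero>\<^bsub>Q\<^esub>"
      by (simp add: free_eval_cls cls_eq_zero_iff)
  qed
  then show ?thesis by (simp add: PI_ring_def)
qed

end

subsection \<open>The free algebra\<close>

lemma free_alg_induct [case_names add single]:
  assumes "\<And>a b. P a \<Longrightarrow> P b \<Longrightarrow> P (a + b)" and "\<And>w c. P (Poly_Mapping.single w c)"
  shows "P (a :: 'v \<Rightarrow>\<^sub>0 'a::comm_monoid_add)"
proof (induction a rule: Poly_Mapping.update_induct)
  case const
  show ?case using assms(2)[of undefined 0] by simp
next
  case (update f w c)
  have "Poly_Mapping.update w c f = f + Poly_Mapping.single w c"
    using update(1)
    by (intro poly_mapping_eqI) (auto simp: lookup_update lookup_add lookup_single in_keys_iff)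
  with update(3) assms show ?case by simp
qed

lemma single_mult_single:
  "Poly_Mapping.single u a * Poly_Mapping.single v b = (Poly_Mapping.single (u @ v) (a * b) :: ('v, 'a::semiring_0) free_alg)"
  by (simp add: mult_single plus_list_def)

lemma free_const_mult: "free_const a * free_const b = (free_const (a * b) :: ('v, 'a::semiring_0) free_alg)"
  by (simp add: free_const_def single_mult_single)

lemma free_const_add: "free_const a + free_const b = free_const (a + b)"
  by (simp add: free_const_def single_add)

lemma free_const_1: "free_const 1 = 1"
  by (simp add: free_const_def flip: zero_list_def)

lemma free_const_0: "free_const 0 = 0"
  by (simp add: free_const_def)

lemma free_const_power: "free_const a ^ n = (free_const (a ^ n) :: ('v, 'a::semiring_1) free_alg)"
  by (induction n) (simp_all add: free_const_1 free_const_mult)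

lemma free_const_commute:
  "free_const c * a = a * (free_const c :: ('v, 'a::comm_semiring_0) free_alg)"
  by (induction a rule: free_alg_induct)
    (simp_all add: distrib_left distrib_right free_const_def single_mult_single mult.commute)

text \<open>A monomial arises from a scalar by multiplying letters on the left. This is the
  induction behind the centrality criterion and behind the closure of the span under left
  multiplication.\<close>

lemma free_alg_gen_induct [case_names const var add mult]:
  assumes const: "\<And>c. P (free_const c)" and var: "\<And>v. P (free_var v)"
    and add: "\<And>a b. P a \<Longrightarrow> P b \<Longrightarrow> P (a + b)" and mult: "\<And>a b. P a \<Longrightarrow> P b \<Longrightarrow> P (a * b)"
  shows "P (a :: ('v, 'a::semiring_1) free_alg)"
proof (induction a rule: free_alg_induct)
  case (single w c)
  show ?case
  proof (induction w)
    case Nil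
    show ?case using const[of c] by (simp add: free_const_def)
  next
    case (Cons v w)
    show ?case
      using mult[OF var[of v] Cons] by (simp add: free_var_def single_mult_single)
  qed
qed (rule add)

subsection \<open>The action on power series\<close>

text \<open>
  A sequence \<open>f\<close> stands for the power series $\sum_i f_i t^i$.
\<close>

fun gen_act :: "'a::field \<Rightarrow> gen \<Rightarrow> (nat \<Rightarrow> 'a) \<Rightarrow> nat \<Rightarrow> 'a" where
  "gen_act q Gx f i = (if i = 0 then 0 else f (i - 1))"
| "gen_act q Gy f i = of_nat (Suc i) * q ^ i * f (Suc i)"
| "gen_act q Gz f i = q ^ i * f i"

definition word_act :: "'a::field \<Rightarrow> gen list \<Rightarrow> (nat \<Rightarrow> 'a) \<Rightarrow> nat \<Rightarrow> 'a" where
  "word_act q w f = foldr (gen_act q) w f"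

definition alg_act :: "'a::field \<Rightarrow> (gen, 'a) free_alg \<Rightarrow> (nat \<Rightarrow> 'a) \<Rightarrow> nat \<Rightarrow> 'a" where
  "alg_act q a f i = (\<Sum>w\<in>Poly_Mapping.keys a. Poly_Mapping.lookup a w * word_act q w f i)"

lemma alg_act_add: "alg_act q (a + b) f = (\<lambda>i. alg_act q a f i + alg_act q b f i)"
  unfolding alg_act_def
  by (intro ext setsum_keys_plus_distrib) (simp_all add: algebra_simps)

lemma alg_act_single: "alg_act q (Poly_Mapping.single w c) f = (\<lambda>i. c * word_act q w f i)"
  by (cases "c = 0") (simp_all add: alg_act_def fun_eq_iff)

text \<open>One formula serves three uses: \<open>c = 1\<close> gives additivity,
  \<open>g = 0\<close> homogeneity, and \<open>c = - 1\<close> with zero sequences shows that zero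
  is fixed.\<close>

lemma word_act_linear:
  "word_act q w (\<lambda>i. c * f i + g i) = (\<lambda>i. c * word_act q w f i + word_act q w g i)"
proof (induction w)
  case Nil
  then show ?case by (simp add: word_act_def)
next
  case (Cons v w)
  have "gen_act q v (\<lambda>i. c * f i + g i) = (\<lambda>i. c * gen_act q v f i + gen_act q v g i)" for f g
    by (cases v) (auto simp: algebra_simps)
  with Cons show ?case by (simp add: word_act_def)
qed

lemma word_act_zero: "word_act q w (\<lambda>i. 0) = (\<lambda>i. 0)"
  using word_act_linear[of q w "- 1" "\<lambda>i. 0" "\<lambda>i. 0"] by simp

lemma alg_act_zero_vector: "alg_act q a (\<lambda>i. 0) = (\<lambda>i. 0)"
  by (simp add: alg_act_def word_act_zero fun_eq_iff)

text \<open>On words, concatenation is composition, the rightmost letter acting first; linearity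
  extends this to both factors.\<close>

lemma alg_act_mult: "alg_act q (a * b) f = alg_act q a (alg_act q b f)"
proof (induction a rule: free_alg_induct)
  case (add a a')
  then show ?case by (simp add: distrib_right alg_act_add)
next
  case (single u c)
  show ?case
  proof (induction b rule: free_alg_induct)
    case (add b b')
    show ?case
      using add word_act_linear[of q u 1 "alg_act q b f" "alg_act q b' f"]
      by (simp add: distrib_left alg_act_add alg_act_single)
  next
    case (single v d)
    show ?case
      using word_act_linear[of q u d "word_act q v f" "\<lambda>i. 0"]
      by (simp add: single_mult_single alg_act_single word_act_zero)
        (simp add: word_act_def fun_eq_iff)
  qed
qed

lemma alg_act_zero: "alg_act q 0 f = (\<lambda>i. 0)"
  by (simp add: alg_act_def fun_eq_iff)

lemma alg_act_uminus: "alg_act q (- a) f = (\<lambda>i. - alg_act q a f i)"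
  using alg_act_add[of q "- a" a f] by (simp add: alg_act_zero fun_eq_iff add_eq_0_iff)

lemma alg_act_diff: "alg_act q (a - b) f = (\<lambda>i. alg_act q a f i - alg_act q b f i)"
  using alg_act_add[of q a "- b" f] by (simp add: alg_act_uminus)

lemma alg_act_const: "alg_act q (free_const c) f = (\<lambda>i. c * f i)"
  by (simp add: free_const_def alg_act_single word_act_def)

lemma alg_act_one: "alg_act q 1 f = f"
  using alg_act_const[of q 1 f] by (simp add: free_const_def flip: zero_list_def)

lemma alg_act_var: "alg_act q (free_var v) f = gen_act q v f"
  by (simp add: free_var_def alg_act_single word_act_def)

text \<open>The third relation is the product rule: the derivative of \<open>t f(t)\<close> at
  \<open>q t\<close> is \<open>q t f'(q t) + f(q t)\<close>. The other two compare powers of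
  \<open>q\<close> coefficientwise.\<close>

lemma alg_act_relations:
  assumes "q \<noteq> 0" and "r \<in> Hq_relations q"
  shows "alg_act q r f = (\<lambda>i. 0)"
  using assms(2)
  unfolding Hq_relations_def Let_def
proof (elim insertE emptyE)
  assume r: "r = free_var Gz * free_var Gx - free_const q * free_var Gx * free_var Gz"
  have "q ^ i * f (i - 1) = q * (q ^ (i - 1) * f (i - 1))" if "i \<noteq> 0" for i
    using that by (cases i) auto
  then show ?thesis
    unfolding r by (auto simp: alg_act_diff alg_act_mult alg_act_var alg_act_const fun_eq_iff)
next
  assume r: "r = free_var Gz * free_var Gy - free_const (inverse q) * free_var Gy * free_var Gz"
  show ?thesis
    unfolding r using assms(1)
    by (simp add: alg_act_diff alg_act_mult alg_act_var alg_act_const fun_eq_iff field_simps)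
next
  assume r: "r = free_var Gy * free_var Gx - free_const q * free_var Gx * free_var Gy - free_var Gz"
  have "alg_act q r f i = 0" for i
    unfolding r by (cases i)
      (simp_all add: alg_act_diff alg_act_mult alg_act_var alg_act_const alg_act_add algebra_simps)
  then show ?thesis by blast
qed

abbreviation Hq_ideal :: "'a::field \<Rightarrow> (gen, 'a) free_alg set" where
  "Hq_ideal q \<equiv> Idl\<^bsub>ring_of_type_algebra\<^esub> (Hq_relations q)"

lemma ideal_Hq_ideal: "ideal (Hq_ideal q) ring_of_type_algebra"
  by (rule ring.genideal_ideal[OF ring_of_type_algebra_ring]) (simp add: ring_of_type_algebra_def)

text \<open>The annihilator of the module is a two-sided ideal containing the relations, hence
  contains the ideal they generate.\<close>

lemma alg_act_Hq_ideal:
  assumes "q \<noteq> 0" and "a \<in> Hq_ideal q"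
  shows "alg_act q a f = (\<lambda>i. 0)"
proof -
  have "ideal {a. \<forall>f. alg_act q a f = (\<lambda>i. 0)} ring_of_type_algebra"
    by (rule ideal_ring_of_type_algebraI)
      (simp_all add: alg_act_zero alg_act_add alg_act_mult alg_act_zero_vector)
  moreover have "Hq_relations q \<subseteq> {a. \<forall>f. alg_act q a f = (\<lambda>i. 0)}"
    using alg_act_relations[OF assms(1)] by blast
  ultimately show ?thesis
    using assms(2) by (auto simp: genideal_def)
qed

section \<open>Diagonal operators realised by the algebra\<close>

definition diag_functions :: "'a::field \<Rightarrow> (nat \<Rightarrow> 'a) set" where
  "diag_functions q = {h. \<exists>a. \<forall>f. alg_act q a f = (\<lambda>i. h i * f i)}"

lemma diag_functions_const: "(\<lambda>i. c) \<in> diag_functions q"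
  unfolding diag_functions_def using alg_act_const by blast

lemma diag_functions_add:
  assumes "g \<in> diag_functions q" "h \<in> diag_functions q"
  shows "(\<lambda>i. g i + h i) \<in> diag_functions q"
proof -
  obtain a b where "\<forall>f. alg_act q a f = (\<lambda>i. g i * f i)" "\<forall>f. alg_act q b f = (\<lambda>i. h i * f i)"
    using assms by (auto simp: diag_functions_def)
  then have "\<forall>f. alg_act q (a + b) f = (\<lambda>i. (g i + h i) * f i)"
    by (simp add: alg_act_add distrib_right)
  then show ?thesis by (auto simp: diag_functions_def)
qed

lemma diag_functions_mult:
  assumes "g \<in> diag_functions q" "h \<in> diag_functions q"
  shows "(\<lambda>i. g i * h i) \<in> diag_functions q"
proof -
  obtain a b where "\<forall>f. alg_act q a f = (\<lambda>i. g i * f i)" "\<forall>f. alg_act q b f = (\<lambda>i. h i * f i)"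
    using assms by (auto simp: diag_functions_def)
  then have "\<forall>f. alg_act q (a * b) f = (\<lambda>i. (g i * h i) * f i)"
    by (simp add: alg_act_mult mult.assoc)
  then show ?thesis by (auto simp: diag_functions_def)
qed

text \<open>For \<open>i > 0\<close>, the element \<open>q x y z^(n-1)\<close> scales
  \<open>t^i\<close> by \<open>q * i q^(i-1) * q^(i(n-1)) = i q^(i n) = i\<close>; it kills
  \<open>1\<close>.\<close>

lemma diag_functions_of_nat:
  assumes "n > 0" and "q ^ n = 1"
  shows "of_nat \<in> diag_functions q"
proof -
  let ?x = "free_var Gx" and ?y = "free_var Gy" and ?z = "free_var Gz"
  have pow: "alg_act q (?z ^ k) f = (\<lambda>i. q ^ (i * k) * f i)" for k f
    by (induction k arbitrary: f)
      (simp_all add: alg_act_one alg_act_mult alg_act_var power_add mult_ac fun_eq_iff)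
  have "alg_act q (free_const q * ?x * ?y * ?z ^ (n - 1)) f i = of_nat i * f i" for f i
  proof (cases i)
    case 0
    then show ?thesis by (simp add: alg_act_const alg_act_mult alg_act_var)
  next
    case (Suc j)
    have "q * q ^ j * q ^ (i * (n - 1)) = q ^ (i * n)"
      using assms(1) Suc by (cases n) (simp_all flip: power_add power_Suc)
    also have "\<dots> = 1"
      using assms(2) by (metis mult.commute power_mult power_one)
    finally show ?thesis
      using Suc by (simp add: alg_act_const alg_act_mult alg_act_var pow) (simp add: algebra_simps)
  qed
  then show ?thesis
    unfolding diag_functions_def by blast
qed

text \<open>Newton interpolation: the product \<open>p d\<close> vanishes at
  \<open>0, ..., d-1\<close> and equals \<open>d!\<close> at \<open>d\<close>, which is nonzero in
  characteristic 0. A multiple of it corrects the value at \<open>d\<close> without disturbing the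
  earlier ones.\<close>

lemma diag_functions_interpolate:
  fixes q :: "'a::field"
  assumes "CHAR('a) = 0" and "n > 0" and "q ^ n = 1"
  shows "\<exists>h\<in>diag_functions q. \<forall>m<d. h m = g m"
proof (induction d)
  case 0
  show ?case using diag_functions_const by auto
next
  case (Suc d)
  define p :: "nat \<Rightarrow> nat \<Rightarrow> 'a" where "p e i = (\<Prod>m<e. of_nat i - of_nat m)" for e i
  have "p e \<in> diag_functions q" for e
  proof (induction e)
    case 0
    show ?case using diag_functions_const[of 1 q] by (simp add: p_def [abs_def])
  next
    case (Suc e)
    have "(\<lambda>i. of_nat i + - of_nat e) \<in> diag_functions q"
      by (intro diag_functions_add diag_functions_const diag_functions_of_nat[of n] assms)
    then show ?case
      using diag_functions_mult[OF Suc] by (simp add: p_def [abs_def])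
  qed
  moreover obtain h where h: "h \<in> diag_functions q" "\<forall>m<d. h m = g m"
    using Suc by blast
  ultimately have "(\<lambda>i. h i + (g d - h d) / p d d * p d i) \<in> diag_functions q"
    by (intro diag_functions_add diag_functions_mult diag_functions_const)
  moreover have "p d d \<noteq> 0"
  proof -
    have "of_nat d - of_nat m \<noteq> (0 :: 'a)" if "m < d" for m
    proof -
      have "of_nat d - of_nat m = (of_nat (d - m) :: 'a)" using that by (simp add: of_nat_diff)
      then show ?thesis using that assms(1) by (simp only: of_nat_eq_0_iff_char_dvd) simp
    qed
    then show ?thesis by (simp add: p_def)
  qed
  moreover have "p d m = 0" if "m < d" for m
    using that by (auto simp: p_def)
  ultimately show ?case
    using h(2) by (intro bexI[of _ "\<lambda>i. h i + (g d - h d) / p d d * p d i"]) (auto simp: less_Suc_eq)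
qed

lemma alg_act_sum: "alg_act q (sum g A) f i = (\<Sum>w\<in>A. alg_act q (g w) f i)"
  by (induction A rule: infinite_finite_induct) (simp_all add: alg_act_zero alg_act_add)

lemma alg_act_of_int: "alg_act q (of_int k) f i = of_int k * f i"
proof -
  have "of_int k = (free_const (of_int k) :: (gen, 'a) free_alg)"
    by (simp add: free_const_def flip: zero_list_def)
  then show ?thesis by (simp add: alg_act_const)
qed

lemma not_poly_value_in_ideal:
  fixes q :: "'a::field"
  assumes "CHAR('a) = 0" and "n > 0" and "q ^ n = 1" and "q \<noteq> 0" and "monic_free f"
  shows "\<exists>s. poly_value s f \<notin> Hq_ideal q"
proof -
  obtain w where w: "w \<in> Poly_Mapping.keys f" "Poly_Mapping.lookup f w = 1"
    "\<And>u. u \<in> Poly_Mapping.keys f \<Longrightarrow> length u \<le> length w"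
    using assms(5) by (auto simp: monic_free_def)
  define d where "d = length w"
  define g where "g v m = (if w ! (d - Suc m) = v then 1 else 0 :: 'a)" for v m
  have "\<exists>a. \<exists>h. (\<forall>f. alg_act q a f = (\<lambda>i. h i * f i)) \<and> (\<forall>m<d. h m = g v m)" for v
    using diag_functions_interpolate[OF assms(1-3), of d "g v"] by (auto simp: diag_functions_def)
  then obtain D h where D: "\<And>v f. alg_act q (D v) f = (\<lambda>i. h v i * f i)"
    and h: "\<And>v m. m < d \<Longrightarrow> h v m = g v m"
    by metis
  \<comment> \<open>\<open>s v\<close> moves \<open>t\<^sup>m\<close> to \<open>t\<^sup>m\<^sup>+\<^sup>1\<close> if \<open>v\<close> is the letter of \<open>w\<close> preceded by its last \<open>m\<close> letters on the
    right, and kills \<open>t\<^sup>m\<close> otherwise; hence of all words of length at most \<open>d\<close>, only \<open>w\<close> moves \<open>1\<close> to \<open>t\<^sup>d\<close>.\<close>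
  define s where "s v = free_var Gx * D v" for v
  define e :: "nat \<Rightarrow> nat \<Rightarrow> 'a" where "e j i = (if i = j then 1 else 0)" for j i
  \<comment> \<open>The word \<open>u\<close> is read from the right: it carries \<open>1\<close> to
    \<open>t^(length u)\<close> when it is a suffix of \<open>w\<close>, and to 0 otherwise.
    Prepending a letter tests the next letter of \<open>w\<close> to the left.\<close>
  have act: "alg_act q (prod_list (map s u)) (e 0) =
      (\<lambda>i. (if u = drop (d - length u) w then 1 else 0) * e (length u) i)"
    if "length u \<le> d" for u
    using that
  proof (induction u)
    case Nil
    show ?case by (simp add: alg_act_one d_def)
  next
    case (Cons v u)
    then have len: "d - length u = Suc (d - Suc (length u))" "d - Suc (length u) < length w"
      by (auto simp: d_def)
    have "drop (d - Suc (length u)) w = w ! (d - Suc (length u)) # drop (d - length u) w"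
      using len by (metis Cons_nth_drop_Suc)
    with Cons show ?case
      by (auto simp: s_def alg_act_mult alg_act_var D h g_def e_def fun_eq_iff)
  qed
  \<comment> \<open>By maximality of \<open>w\<close> every word of \<open>f\<close> has length at
    most \<open>d\<close>. Shorter words end below degree \<open>d\<close>, so the coefficient of
    \<open>t^d\<close> sees only \<open>w\<close>.\<close>
  have "alg_act q (poly_value s f) (e 0) d =
      (\<Sum>u\<in>Poly_Mapping.keys f. of_int (Poly_Mapping.lookup f u) * (if u = w then 1 else 0))"
    unfolding poly_value_def alg_act_sum
  proof (intro sum.cong refl)
    fix u assume "u \<in> Poly_Mapping.keys f"
    then have "length u \<le> d" using w(3) by (simp add: d_def)
    then show "alg_act q (of_int (Poly_Mapping.lookup f u) * prod_list (map s u)) (e 0) d =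
        of_int (Poly_Mapping.lookup f u) * (if u = w then 1 else 0)"
      by (auto simp: alg_act_mult alg_act_of_int act e_def d_def)
  qed
  also have "\<dots> = 1"
    using w(1,2) by (simp add: if_distrib sum.delta cong: if_cong)
  finally have "alg_act q (poly_value s f) (e 0) \<noteq> (\<lambda>i. 0)"
    by (metis zero_neq_one)
  then show ?thesis
    using alg_act_Hq_ideal[OF assms(4)] by blast
qed

subsection \<open>The standard identity\<close>

lemma poly_value_add: "poly_value s (f + g) = poly_value s f + poly_value s g"
  unfolding poly_value_def by (rule setsum_keys_plus_distrib) (simp_all add: distrib_right)

lemma poly_value_single: "poly_value s (Poly_Mapping.single w c) = of_int c * prod_list (map s w)"
  by (cases "c = 0") (simp_all add: poly_value_def)

lemma poly_value_sum: "poly_value s (sum g A) = (\<Sum>i\<in>A. poly_value s (g i))"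
proof (induction A rule: infinite_finite_induct)
  have "poly_value s 0 = 0" by (simp add: poly_value_def)
  then show "poly_value s (sum g A) = (\<Sum>i\<in>A. poly_value s (g i))" if "infinite A" for A
    using that by simp
  show "poly_value s (sum g {}) = (\<Sum>i\<in>{}. poly_value s (g i))"
    by (simp add: poly_value_def)
qed (simp add: poly_value_add)

definition standard_poly :: "nat \<Rightarrow> (nat, int) free_alg" where
  "standard_poly m = (\<Sum>p | p permutes {..<m}. Poly_Mapping.single (map p [0..<m]) (sign p))"

text \<open>Only the identity permutation produces the word \<open>[0..<m]\<close>, so its
  coefficient 1 suffers no cancellation, and all words have the same length
  \<open>m\<close>.\<close>

lemma monic_standard_poly: "monic_free (standard_poly m)"
proof -
  have id: "p = id" if "p permutes {..<m}" "map p [0..<m] = [0..<m]" for p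
  proof
    fix i
    show "p i = id i"
    proof (cases "i < m")
      case True
      then show ?thesis using arg_cong[OF that(2), of "\<lambda>l. l ! i"] by simp
    next
      case False
      then show ?thesis using that(1) by (simp add: permutes_not_in)
    qed
  qed
  have "Poly_Mapping.lookup (standard_poly m) [0..<m] =
      (\<Sum>p | p permutes {..<m}. if p = id then 1 else 0)"
    unfolding standard_poly_def lookup_sum
  proof (intro sum.cong refl)
    fix p assume "p \<in> {p. p permutes {..<m}}"
    then show "Poly_Mapping.lookup (Poly_Mapping.single (map p [0..<m]) (sign p)) [0..<m] =
        (if p = id then 1 else 0)"
      using id[of p] by (auto simp: lookup_single when_def)
  qed
  also have "\<dots> = 1"
    by (simp add: finite_permutations permutes_id)
  finally have "Poly_Mapping.lookup (standard_poly m) [0..<m] = 1" .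
  moreover have "length u = m" if "u \<in> Poly_Mapping.keys (standard_poly m)" for u
  proof -
    have "(\<Sum>p | p permutes {..<m}.
        Poly_Mapping.lookup (Poly_Mapping.single (map p [0..<m]) (sign p)) u) \<noteq> 0"
      using that by (simp add: standard_poly_def in_keys_iff lookup_sum)
    then obtain p where "Poly_Mapping.lookup (Poly_Mapping.single (map p [0..<m]) (sign p)) u \<noteq> 0"
      by (rule sum.not_neutral_contains_not_neutral)
    then show ?thesis by (auto simp: lookup_single when_def split: if_splits)
  qed
  ultimately show ?thesis
    unfolding monic_free_def by (intro bexI[of _ "[0..<m]"]) (auto simp: in_keys_iff)
qed

lemma poly_value_standard_poly:
  "poly_value r (standard_poly m) =
     (\<Sum>p | p permutes {..<m}. of_int (sign p) * prod_list (map (\<lambda>i. r (p i)) [0..<m]))"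
  by (simp add: standard_poly_def poly_value_sum poly_value_single comp_def)

text \<open>
  Swapping the equal arguments only gives $s = -s$, which is void in characteristic 2; the terms are
  therefore cancelled in pairs, an even permutation against an odd one.
\<close>

lemma standard_poly_repeated:
  fixes r :: "nat \<Rightarrow> 'a::ring_1"
  assumes "i < m" "j < m" "i \<noteq> j" "r i = r j"
  shows "poly_value r (standard_poly m) = 0"
proof -
  let ?t = "Transposition.transpose i j"
  let ?S = "{p. p permutes {..<m}}"
  let ?f = "\<lambda>p. of_int (sign p) * prod_list (map (\<lambda>i. r (p i)) [0..<m])"
  have t: "?t permutes {..<m}"
    using assms by (intro permutes_swap_id) auto
  have perm: "permutation p" if "p \<in> ?S" for p
    using that finite_lessThan permutation_permutes by blast
  have sgn: "sign (?t \<circ> p) = - sign p" if "p \<in> ?S" for p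
    using perm[OF that] assms(3) by (subst sign_compose) (auto simp: sign_swap_id permutation_swap_id)
  \<comment> \<open>Transposing on the side of the variable names leaves the value of each word
    unchanged, so only the sign flips.\<close>
  have "r (?t k) = r k" for k
    using assms(4) by (auto simp: Transposition.transpose_def)
  then have neg: "?f (?t \<circ> p) = - ?f p" if "p \<in> ?S" for p
    using sgn[OF that] by simp
  have odd_even: "sum ?f {p \<in> ?S. sign p = - 1} = (\<Sum>p\<in>{p \<in> ?S. sign p = 1}. ?f (?t \<circ> p))"
  proof (rule sum.reindex_bij_witness[of _ "\<lambda>p. ?t \<circ> p" "\<lambda>p. ?t \<circ> p"])
    fix p assume p: "p \<in> {p \<in> ?S. sign p = - 1}"
    then show "?t \<circ> p \<in> {p \<in> ?S. sign p = 1}"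
      using sgn[of p] t by (auto intro: permutes_compose)
    show "?t \<circ> (?t \<circ> p) = p" by (simp add: fun_eq_iff)
    then show "?f (?t \<circ> (?t \<circ> p)) = ?f p" by simp
  next
    fix p assume p: "p \<in> {p \<in> ?S. sign p = 1}"
    then show "?t \<circ> p \<in> {p \<in> ?S. sign p = - 1}"
      using sgn[of p] t by (auto intro: permutes_compose)
    show "?t \<circ> (?t \<circ> p) = p" by (simp add: fun_eq_iff)
  qed
  have "?S = {p \<in> ?S. sign p = 1} \<union> {p \<in> ?S. sign p = - 1}"
    by (auto simp: sign_def)
  then have "sum ?f ?S = sum ?f ({p \<in> ?S. sign p = 1} \<union> {p \<in> ?S. sign p = - 1})"
    by (rule arg_cong)
  also have "\<dots> = sum ?f {p \<in> ?S. sign p = 1} + sum ?f {p \<in> ?S. sign p = - 1}"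
    by (rule sum.union_disjoint) (auto simp: finite_permutations)
  also have "sum ?f {p \<in> ?S. sign p = - 1} = (\<Sum>p\<in>{p \<in> ?S. sign p = 1}. - ?f p)"
    unfolding odd_even by (rule sum.cong[OF refl], rule neg) simp
  finally show ?thesis
    by (simp add: poly_value_standard_poly sum_negf)
qed

text \<open>Multilinearity: each variable occurs exactly once in every word, so the cofactors
  \<open>L p\<close> and \<open>R p\<close> do not depend on what is put into slot
  \<open>i\<close>.\<close>

lemma standard_poly_slot:
  fixes r :: "nat \<Rightarrow> 'a::ring_1"
  assumes "i < m"
  obtains L R where "\<And>a. poly_value (r(i := a)) (standard_poly m) =
    (\<Sum>p | p permutes {..<m}. L p * a * R p)"
proof -
  have "\<exists>L R. \<forall>a. of_int (sign p) * prod_list (map (\<lambda>j. (r(i := a)) (p j)) [0..<m]) = L * a * R"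
    if p: "p permutes {..<m}" for p
  proof -
    have "i \<in> set (map p [0..<m])"
      using permutes_image[OF p] assms by (simp add: atLeast0LessThan)
    then obtain us vs where w: "map p [0..<m] = us @ i # vs"
      using split_list by metis
    moreover have "distinct (map p [0..<m])"
      using permutes_inj_on[OF p] by (simp add: distinct_map)
    \<comment> \<open>Distinctness keeps \<open>i\<close> out of \<open>us\<close> and
      \<open>vs\<close>, so the update does not reach them.\<close>
    ultimately have "map (r(i := a)) us = map r us" "map (r(i := a)) vs = map r vs" for a
      by (auto intro!: map_cong)
    note us_vs = this
    have "prod_list (map (r(i := a)) (map p [0..<m])) = prod_list (map r us) * a * prod_list (map r vs)" for a
      unfolding w by (simp add: us_vs[of a] mult.assoc del: map_eq_conv fun_upd_apply) simp
    moreover have "map (\<lambda>j. (r(i := a)) (p j)) [0..<m] = map (r(i := a)) (map p [0..<m])" for a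
      by simp
    ultimately have "of_int (sign p) * prod_list (map (\<lambda>j. (r(i := a)) (p j)) [0..<m]) =
        (of_int (sign p) * prod_list (map r us)) * a * prod_list (map r vs)" for a
      by (simp only: mult.assoc)
    then show ?thesis by blast
  qed
  then obtain L R where LR: "\<And>p a. p permutes {..<m} \<Longrightarrow>
      of_int (sign p) * prod_list (map (\<lambda>j. (r(i := a)) (p j)) [0..<m]) = L p * a * R p"
    by metis
  show thesis
    by (rule that[of L R]) (auto simp: poly_value_standard_poly LR simp del: fun_upd_apply intro!: sum.cong)
qed

section \<open>Congruence, centrality and spans modulo a two-sided ideal\<close>

locale two_sided_ideal =
  fixes I :: "'a::ring_1 set"
  assumes zero_mem: "0 \<in> I"
    and add_mem: "\<And>a b. a \<in> I \<Longrightarrow> b \<in> I \<Longrightarrow> a + b \<in> I"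
    and left_mem: "\<And>a b. b \<in> I \<Longrightarrow> a * b \<in> I"
    and right_mem: "\<And>a b. a \<in> I \<Longrightarrow> a * b \<in> I"
begin

definition congr :: "'a \<Rightarrow> 'a \<Rightarrow> bool" (infix "\<asymp>" 50) where
  "a \<asymp> b \<longleftrightarrow> a - b \<in> I"

lemma congr_refl [simp]: "a \<asymp> a"
  by (simp add: congr_def zero_mem)

lemma congr_sym: "a \<asymp> b \<Longrightarrow> b \<asymp> a"
  unfolding congr_def using left_mem[of "a - b" "- 1"] by simp

lemma congr_trans [trans]: "a \<asymp> b \<Longrightarrow> b \<asymp> c \<Longrightarrow> a \<asymp> c"
  unfolding congr_def using add_mem[of "a - b" "b - c"] by simp

lemma congr_add: "a \<asymp> a' \<Longrightarrow> b \<asymp> b' \<Longrightarrow> a + b \<asymp> a' + b'"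
  unfolding congr_def using add_mem[of "a - a'" "b - b'"] by (simp add: algebra_simps)

lemma congr_mult:
  assumes "a \<asymp> a'" "b \<asymp> b'"
  shows "a * b \<asymp> a' * b'"
proof -
  have "a * b - a' * b' = a * (b - b') + (a - a') * b'"
    by (simp add: algebra_simps)
  with assms show ?thesis
    by (simp add: congr_def add_mem left_mem right_mem)
qed

lemma congr_zero_iff: "a \<asymp> 0 \<longleftrightarrow> a \<in> I"
  by (simp add: congr_def)

lemma congr_mem: "a \<asymp> b \<Longrightarrow> b \<in> I \<Longrightarrow> a \<in> I"
  using congr_trans congr_zero_iff by blast

lemma congr_sum: "(\<And>i. i \<in> A \<Longrightarrow> f i \<asymp> g i) \<Longrightarrow> sum f A \<asymp> sum g A"
  by (induction A rule: infinite_finite_induct) (auto intro: congr_add)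

text \<open>These are the representatives of central elements of the quotient by
  \<open>I\<close>.\<close>

definition central :: "'a \<Rightarrow> bool" where
  "central c \<longleftrightarrow> (\<forall>a. c * a \<asymp> a * c)"

lemma centralD: "central c \<Longrightarrow> c * a \<asymp> a * c"
  by (simp add: central_def)

text \<open>For nonempty \<open>B\<close> this is the preimage of the submodule that
  \<open>B\<close> generates in the quotient over its centre; rule \<open>congr\<close> saturates it
  under the ideal. The inductive form lets multilinear expansions run as rule inductions.\<close>

inductive_set spanned :: "'a set \<Rightarrow> 'a set" for B where
  base: "b \<in> B \<Longrightarrow> b \<in> spanned B"
| add: "a \<in> spanned B \<Longrightarrow> b \<in> spanned B \<Longrightarrow> a + b \<in> spanned B"
| scale: "central c \<Longrightarrow> a \<in> spanned B \<Longrightarrow> c * a \<in> spanned B"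
| congr: "a \<in> spanned B \<Longrightarrow> a \<asymp> b \<Longrightarrow> b \<in> spanned B"

text \<open>Expanding each argument over \<open>B\<close> by multilinearity leaves values with all
  arguments in \<open>B\<close>; by pigeonhole two of these coincide, and the alternating property
  gives zero.\<close>

lemma standard_poly_mem_if_spanned:
  assumes "finite B" "card B < m" "spanned B = UNIV"
  shows "poly_value r (standard_poly m) \<in> I"
proof -
  \<comment> \<open>The first \<open>k\<close> slots are still arbitrary, the remaining ones already
    lie in \<open>B\<close>. The induction step frees slot \<open>k\<close>; the claim for
    \<open>k = m\<close> is the goal.\<close>
  have "poly_value r (standard_poly m) \<in> I" if "k \<le> m" "\<And>i. k \<le> i \<Longrightarrow> i < m \<Longrightarrow> r i \<in> B" for k r
    using that
  proof (induction k arbitrary: r)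
    case 0
    then have "r ` {..<m} \<subseteq> B" by auto
    then have "\<not> inj_on r {..<m}"
      using assms(1,2) card_inj_on_le[of r "{..<m}" B] by auto
    then obtain i j where "i < m" "j < m" "i \<noteq> j" "r i = r j"
      by (auto simp: inj_on_def)
    then show ?case
      by (simp add: standard_poly_repeated zero_mem)
  next
    case (Suc k)
    then obtain L R where LR: "\<And>a. poly_value (r(k := a)) (standard_poly m) =
        (\<Sum>p | p permutes {..<m}. L p * a * R p)"
      using standard_poly_slot[of k m r] Suc_le_lessD by blast
    have "poly_value (r(k := a)) (standard_poly m) \<in> I" if "a \<in> spanned B" for a
      using that
    proof induction
      case (base b)
      show ?case
        by (rule Suc.IH) (use Suc.prems base in auto)
    next
      case (add a b)
      then show ?case
        unfolding LR using add_mem by (simp add: algebra_simps sum.distrib)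
    next
      case (scale c a)
      have "(\<Sum>p | p permutes {..<m}. L p * (c * a) * R p) \<asymp>
          (\<Sum>p | p permutes {..<m}. c * (L p * a * R p))"
      proof (rule congr_sum)
        fix p
        \<comment> \<open>The scalar \<open>c\<close> sits behind \<open>L p\<close> and has to be
          moved to the front, which is possible only modulo \<open>I\<close>.\<close>
        have "L p * (c * a) * R p = L p * c * (a * R p)" by (simp add: mult.assoc)
        also have "\<dots> \<asymp> c * L p * (a * R p)"
          by (intro congr_mult congr_refl congr_sym[OF centralD] scale)
        finally show "L p * (c * a) * R p \<asymp> c * (L p * a * R p)" by (simp add: mult.assoc)
      qed
      also have "(\<Sum>p | p permutes {..<m}. c * (L p * a * R p)) =
          c * (\<Sum>p | p permutes {..<m}. L p * a * R p)"
        by (simp add: sum_distrib_left)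
      finally show ?case
        using scale.IH unfolding LR by (blast intro: congr_mem left_mem)
    next
      case (congr a b)
      have "(\<Sum>p | p permutes {..<m}. L p * b * R p) \<asymp> (\<Sum>p | p permutes {..<m}. L p * a * R p)"
        by (intro congr_sum congr_mult congr_refl congr_sym[OF congr(2)])
      then show ?case
        using congr.IH unfolding LR by (blast intro: congr_mem)
    qed
    then have "poly_value (r(k := r k)) (standard_poly m) \<in> I"
      using assms(3) by blast
    then show ?case by simp
  qed
  from this[of m r] show ?thesis by simp
qed

lemma congr_mult_left: "a \<asymp> b \<Longrightarrow> c * a \<asymp> c * b"
  by (rule congr_mult[OF congr_refl])

lemma congr_mult_right: "a \<asymp> b \<Longrightarrow> a * c \<asymp> b * c"
  by (rule congr_mult[OF _ congr_refl])

text \<open>Moving \<open>u\<close> past each factor \<open>v\<close> costs one \<open>k\<close>.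
  Here \<open>k\<close> commutes exactly, not just modulo \<open>I\<close>, as scalars do, so the
  factors can be collected in front.\<close>

lemma power_commute_congr:
  assumes "u * v \<asymp> k * (v * u)" and k: "\<And>a. k * a = a * k"
  shows "u * v ^ n \<asymp> k ^ n * (v ^ n * u)"
proof (induction n)
  case (Suc n)
  have "u * v ^ Suc n = (u * v) * v ^ n" by (simp add: mult.assoc)
  also have "\<dots> \<asymp> k * (v * u) * v ^ n" by (rule congr_mult_right[OF assms(1)])
  also have "\<dots> = k * v * (u * v ^ n)" by (simp add: mult.assoc)
  also have "\<dots> \<asymp> k * v * (k ^ n * (v ^ n * u))" by (rule congr_mult_left[OF Suc])
  also have "k * v * (k ^ n * (v ^ n * u)) = k * (v * k ^ n) * (v ^ n * u)" by (simp add: mult.assoc)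
  also have "v * k ^ n = k ^ n * v"
    by (rule power_commuting_commutes[OF k, symmetric])
  finally show ?case by (simp add: mult.assoc)
qed simp

lemma power_commute_congr':
  assumes "u * v \<asymp> k * (v * u)" and k: "\<And>a. k * a = a * k"
  shows "u ^ n * v \<asymp> k ^ n * (v * u ^ n)"
proof (induction n)
  case (Suc n)
  have "u ^ Suc n * v = u * (u ^ n * v)" by (simp add: mult.assoc)
  also have "\<dots> \<asymp> u * (k ^ n * (v * u ^ n))" by (rule congr_mult_left[OF Suc])
  also have "u * (k ^ n * (v * u ^ n)) = (u * k ^ n) * v * u ^ n" by (simp add: mult.assoc)
  also have "u * k ^ n = k ^ n * u"
    by (rule power_commuting_commutes[OF k, symmetric])
  also have "k ^ n * u * v * u ^ n = k ^ n * (u * v) * u ^ n" by (simp add: mult.assoc)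
  also have "\<dots> \<asymp> k ^ n * (k * (v * u)) * u ^ n"
    by (intro congr_mult_right congr_mult_left assms(1))
  also have "k ^ n * (k * (v * u)) * u ^ n = k ^ Suc n * (v * u ^ Suc n)"
    by (simp add: mult.assoc) (simp flip: mult.assoc add: power_commutes)
  finally show ?case .
qed simp

end

subsection \<open>Generation over the centre in positive characteristic\<close>

lemma two_sided_ideal_Hq_ideal: "two_sided_ideal (Hq_ideal q)"
proof -
  interpret ideal "Hq_ideal q" ring_of_type_algebra by (rule ideal_Hq_ideal)
  show ?thesis
    using additive_subgroup.zero_closed[OF additive_subgroup_axioms]
      additive_subgroup.a_closed[OF additive_subgroup_axioms] I_l_closed I_r_closed
    by unfold_locales simp_all
qed

context
  fixes q :: "'a::field"
begin

interpretation H: two_sided_ideal "Hq_ideal q"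
  by (rule two_sided_ideal_Hq_ideal)

notation H.congr (infix "\<asymp>" 50)

private abbreviation "\<kappa> \<equiv> free_const :: 'a \<Rightarrow> (gen, 'a) free_alg"
private abbreviation "x \<equiv> free_var Gx :: (gen, 'a) free_alg"
private abbreviation "y \<equiv> free_var Gy :: (gen, 'a) free_alg"
private abbreviation "z \<equiv> free_var Gz :: (gen, 'a) free_alg"

lemma gens_relations:
  "z * x \<asymp> \<kappa> q * (x * z)" "z * y \<asymp> \<kappa> (inverse q) * (y * z)" "y * x \<asymp> \<kappa> q * (x * y) + z"
proof -
  have "Hq_relations q \<subseteq> Hq_ideal q"
    using ring.genideal_self[OF ring_of_type_algebra_ring, of "Hq_relations q"] by simp
  moreover have "z * x - \<kappa> q * (x * z) \<in> Hq_relations q"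
    "z * y - \<kappa> (inverse q) * (y * z) \<in> Hq_relations q"
    "y * x - (\<kappa> q * (x * y) + z) \<in> Hq_relations q"
    by (simp_all add: Hq_relations_def Let_def mult.assoc diff_diff_eq)
  ultimately show "z * x \<asymp> \<kappa> q * (x * z)" "z * y \<asymp> \<kappa> (inverse q) * (y * z)"
    "y * x \<asymp> \<kappa> q * (x * y) + z"
    unfolding H.congr_def by blast+
qed

lemma const_left_commute: "a * (\<kappa> c * b) = \<kappa> c * (a * b)"
  by (metis free_const_commute mult.assoc)

lemmas var_const_left_commute =
  const_left_commute[of "free_var v" for v] const_left_commute[of "free_var v ^ n" for v n]

lemma const_mult_assoc: "\<kappa> c * (\<kappa> d * b) = \<kappa> (c * d) * b"
  by (simp add: free_const_mult flip: mult.assoc)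

lemma z_x_power: "z * x ^ i \<asymp> \<kappa> (q ^ i) * (x ^ i * z)"
  using H.power_commute_congr[OF gens_relations(1) free_const_commute] by (simp add: free_const_power)

lemma z_y_power: "z * y ^ i \<asymp> \<kappa> (inverse q ^ i) * (y ^ i * z)"
  using H.power_commute_congr[OF gens_relations(2) free_const_commute] by (simp add: free_const_power)

lemma z_power_x: "z ^ i * x \<asymp> \<kappa> (q ^ i) * (x * z ^ i)"
  using H.power_commute_congr'[OF gens_relations(1) free_const_commute] by (simp add: free_const_power)

lemma z_power_y: "z ^ i * y \<asymp> \<kappa> (inverse q ^ i) * (y * z ^ i)"
  using H.power_commute_congr'[OF gens_relations(2) free_const_commute] by (simp add: free_const_power)

text \<open>When \<open>y\<close> passes a letter \<open>x\<close> after \<open>l\<close> others, it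
  leaves a \<open>z\<close> with factor \<open>q^l\<close>, and this \<open>z\<close> gains
  \<open>q^(i-l)\<close> from the \<open>i-l\<close> letters to its right. Thus each of the
  \<open>i+1\<close> passages contributes \<open>q^i\<close>. Using \<open>Suc i\<close> avoids a
  truncated exponent.\<close>

lemma y_x_power:
  "y * x ^ Suc i \<asymp> \<kappa> (q ^ Suc i) * (x ^ Suc i * y) + \<kappa> (of_nat (Suc i) * q ^ i) * (x ^ i * z)"
proof (induction i)
  case 0
  show ?case using gens_relations(3) by (simp add: free_const_1)
next
  case (Suc i)
  have "y * x ^ Suc (Suc i) = (y * x ^ Suc i) * x"
    by (simp only: power_Suc2 mult.assoc)
  also have "\<dots> \<asymp> (\<kappa> (q ^ Suc i) * (x ^ Suc i * y) + \<kappa> (of_nat (Suc i) * q ^ i) * (x ^ i * z)) * x"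
    by (rule H.congr_mult_right[OF Suc])
  also have "\<dots> = \<kappa> (q ^ Suc i) * x ^ Suc i * (y * x) + \<kappa> (of_nat (Suc i) * q ^ i) * x ^ i * (z * x)"
    by (simp only: distrib_right mult.assoc)
  also have "\<dots> \<asymp> \<kappa> (q ^ Suc i) * x ^ Suc i * (\<kappa> q * (x * y) + z) +
      \<kappa> (of_nat (Suc i) * q ^ i) * x ^ i * (\<kappa> q * (x * z))"
    by (intro H.congr_add H.congr_mult_left gens_relations)
  also have "\<dots> = \<kappa> (q ^ Suc i * q) * (x ^ Suc i * x * y) +
      (\<kappa> (q ^ Suc i) + \<kappa> (of_nat (Suc i) * q ^ i * q)) * (x ^ Suc i * z)"
    by (simp only: distrib_left distrib_right mult.assoc var_const_left_commute const_mult_assoc power_Suc2 add.assoc)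
  also have "\<kappa> (q ^ Suc i) + \<kappa> (of_nat (Suc i) * q ^ i * q) = \<kappa> (of_nat (Suc (Suc i)) * q ^ Suc i)"
    by (simp add: free_const_add algebra_simps)
  finally show ?case
    by (simp only: power_Suc2)
qed

text \<open>Here the factor \<open>q^l\<close> of a leftover \<open>z\<close> is cancelled by the
  \<open>q^(-l)\<close> from moving that \<open>z\<close> past \<open>y^l\<close>, so the last
  coefficient merely counts the passages.\<close>

lemma y_power_x:
  assumes "q \<noteq> 0"
  shows "y ^ Suc j * x \<asymp> \<kappa> (q ^ Suc j) * (x * y ^ Suc j) + \<kappa> (of_nat (Suc j)) * (y ^ j * z)"
proof (induction j)
  case 0
  show ?case using gens_relations(3) by (simp add: free_const_1)
next
  case (Suc j)
  have "y ^ Suc (Suc j) * x = y * (y ^ Suc j * x)"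
    by (simp add: mult.assoc)
  also have "\<dots> \<asymp> y * (\<kappa> (q ^ Suc j) * (x * y ^ Suc j) + \<kappa> (of_nat (Suc j)) * (y ^ j * z))"
    by (rule H.congr_mult_left[OF Suc])
  also have "\<dots> = \<kappa> (q ^ Suc j) * ((y * x) * y ^ Suc j) + \<kappa> (of_nat (Suc j)) * (y ^ Suc j * z)"
    by (simp only: distrib_left mult.assoc var_const_left_commute power_Suc)
  also have "\<dots> \<asymp> \<kappa> (q ^ Suc j) * ((\<kappa> q * (x * y) + z) * y ^ Suc j) +
      \<kappa> (of_nat (Suc j)) * (y ^ Suc j * z)"
    by (intro H.congr_add H.congr_mult_left H.congr_mult_right gens_relations H.congr_refl)
  also have "\<dots> = \<kappa> (q ^ Suc j) * (\<kappa> q * (x * y * y ^ Suc j)) + \<kappa> (q ^ Suc j) * (z * y ^ Suc j) +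
      \<kappa> (of_nat (Suc j)) * (y ^ Suc j * z)"
    by (simp only: distrib_left distrib_right mult.assoc)
  also have "\<dots> \<asymp> \<kappa> (q ^ Suc j) * (\<kappa> q * (x * y * y ^ Suc j)) +
      \<kappa> (q ^ Suc j) * (\<kappa> (inverse q ^ Suc j) * (y ^ Suc j * z)) + \<kappa> (of_nat (Suc j)) * (y ^ Suc j * z)"
    by (intro H.congr_add H.congr_mult_left H.congr_refl z_y_power)
  also have "\<dots> = \<kappa> (q ^ Suc (Suc j)) * (x * y ^ Suc (Suc j)) +
      \<kappa> (q ^ Suc j * inverse q ^ Suc j + of_nat (Suc j)) * (y ^ Suc j * z)"
    by (simp only: const_mult_assoc distrib_right mult.assoc flip: free_const_add)
      (simp add: mult_ac add_ac)
  also have "q ^ Suc j * inverse q ^ Suc j + of_nat (Suc j) = of_nat (Suc (Suc j))"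
    using assms by (simp flip: power_mult_distrib power_Suc)
  finally show ?case .
qed

lemma central_const: "H.central (\<kappa> c)"
  by (simp add: H.central_def free_const_commute)

text \<open>The elements commuting with \<open>c\<close> modulo the ideal form a subalgebra
  containing the scalars.\<close>

lemma central_if_commutes_with_gens:
  assumes "\<And>v. c * free_var v \<asymp> free_var v * c"
  shows "H.central c"
  unfolding H.central_def
proof
  fix a
  show "c * a \<asymp> a * c"
  proof (induction a rule: free_alg_gen_induct)
    case (const k)
    show ?case by (simp flip: free_const_commute)
  next
    case (var v)
    show ?case by (rule assms)
  next
    case (add a b)
    then show ?case by (simp add: distrib_left distrib_right H.congr_add)
  next
    case (mult a b)
    have "c * (a * b) = (c * a) * b" by (simp add: mult.assoc)
    also have "\<dots> \<asymp> a * c * b" by (rule H.congr_mult_right[OF mult(1)])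
    also have "\<dots> = a * (c * b)" by (simp add: mult.assoc)
    also have "\<dots> \<asymp> a * (b * c)" by (rule H.congr_mult_left[OF mult(2)])
    finally show ?case by (simp add: mult.assoc)
  qed
qed

section \<open>Central \<open>N\<close>-th powers of the generators\<close>

context
  fixes N :: nat
  assumes N: "N > 0" and q: "q \<noteq> 0" and q_N: "q ^ N = 1" and N_0: "of_nat N = (0 :: 'a)"
begin

lemma inverse_q_N: "inverse q ^ N = 1"
  using q_N by (simp add: power_inverse)

text \<open>\<open>q ^ N = 1\<close> removes the commutation factors, and \<open>N = 0\<close> in
  the field removes the leftover term in \<open>x^(N-1) z\<close>.\<close>

lemma central_x_power: "H.central (x ^ N)"
proof (rule central_if_commutes_with_gens)
  fix v
  show "x ^ N * free_var v \<asymp> free_var v * x ^ N"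
  proof (cases v)
    case Gx
    then show ?thesis by (simp add: power_commutes)
  next
    case Gy
    then show ?thesis
      using y_x_power[of "N - 1"] N q_N N_0
      by (simp add: free_const_1 free_const_0 H.congr_sym del: of_nat_Suc of_nat_diff)
  next
    case Gz
    then show ?thesis
      using z_x_power[of N] q_N by (simp add: free_const_1 H.congr_sym)
  qed
qed

lemma central_y_power: "H.central (y ^ N)"
proof (rule central_if_commutes_with_gens)
  fix v
  show "y ^ N * free_var v \<asymp> free_var v * y ^ N"
  proof (cases v)
    case Gx
    then show ?thesis
      using y_power_x[OF q, of "N - 1"] N q_N N_0
      by (simp add: free_const_1 free_const_0 del: of_nat_Suc of_nat_diff)
  next
    case Gy
    then show ?thesis by (simp add: power_commutes)
  next
    case Gz
    then show ?thesis
      using z_y_power[of N] inverse_q_N by (simp add: free_const_1 H.congr_sym del: power_inverse)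
  qed
qed

lemma central_z_power: "H.central (z ^ N)"
proof (rule central_if_commutes_with_gens)
  fix v
  show "z ^ N * free_var v \<asymp> free_var v * z ^ N"
    using z_power_x[of N] z_power_y[of N] q_N inverse_q_N
    by (cases v) (simp_all add: free_const_1 power_commutes)
qed

section \<open>Ordered monomials span over the centre\<close>

definition monomial_basis :: "(gen, 'a) free_alg set" where
  "monomial_basis = (\<lambda>(i, j, k). x ^ i * y ^ j * z ^ k) ` ({..<N} \<times> {..<N} \<times> {..<N})"

text \<open>If an exponent reaches \<open>N\<close>, an \<open>N\<close>-th power splits off as a
  central scalar and the total degree drops.\<close>

lemma monomial_spanned: "x ^ i * y ^ j * z ^ k \<in> H.spanned monomial_basis"
proof (induction "i + j + k" arbitrary: i j k rule: less_induct)
  case less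
  have le: "u ^ n = u ^ N * u ^ (n - N)" if "\<not> n < N" for u :: "(gen, 'a) free_alg" and n
    using that by (simp flip: power_add)
  consider "i < N" "j < N" "k < N" | "\<not> i < N" | "\<not> j < N" | "\<not> k < N" by blast
  then show ?case
  proof cases
    case 1
    then show ?thesis by (auto simp: monomial_basis_def intro!: H.spanned.base image_eqI[of _ _ "(i, j, k)"])
  next
    case 2
    have "x ^ N * (x ^ (i - N) * y ^ j * z ^ k) \<in> H.spanned monomial_basis"
      by (rule H.spanned.scale[OF central_x_power less]) (use 2 N in auto)
    then show ?thesis by (simp add: le[OF 2] mult.assoc)
  next
    case 3
    have "y ^ N * (x ^ i * y ^ (j - N) * z ^ k) \<in> H.spanned monomial_basis"
      by (rule H.spanned.scale[OF central_y_power less]) (use 3 N in auto)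
    then have "y ^ N * x ^ i * (y ^ (j - N) * z ^ k) \<in> H.spanned monomial_basis"
      by (simp only: mult.assoc)
    moreover have "y ^ N * x ^ i * (y ^ (j - N) * z ^ k) \<asymp> x ^ i * y ^ N * (y ^ (j - N) * z ^ k)"
      by (rule H.congr_mult_right[OF H.centralD[OF central_y_power]])
    ultimately have "x ^ i * y ^ N * (y ^ (j - N) * z ^ k) \<in> H.spanned monomial_basis"
      by (rule H.spanned.congr)
    then show ?thesis by (simp add: le[OF 3] mult.assoc)
  next
    case 4
    have "z ^ N * (x ^ i * y ^ j * z ^ (k - N)) \<in> H.spanned monomial_basis"
      by (rule H.spanned.scale[OF central_z_power less]) (use 4 N in auto)
    then have "z ^ N * (x ^ i * y ^ j) * z ^ (k - N) \<in> H.spanned monomial_basis"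
      by (simp only: mult.assoc)
    moreover have "z ^ N * (x ^ i * y ^ j) * z ^ (k - N) \<asymp> x ^ i * y ^ j * z ^ N * z ^ (k - N)"
      by (rule H.congr_mult_right[OF H.centralD[OF central_z_power]])
    ultimately have "x ^ i * y ^ j * z ^ N * z ^ (k - N) \<in> H.spanned monomial_basis"
      by (rule H.spanned.congr)
    then show ?thesis by (simp add: le[OF 4] mult.assoc)
  qed
qed

text \<open>This is the shape left when \<open>y\<close> or \<open>z\<close> has passed a power of
  \<open>x\<close>; moving the inner \<open>z\<close> past \<open>y^j\<close> restores normal order
  up to a scalar.\<close>

lemma z_monomial_spanned: "x ^ i * (z * (y ^ j * z ^ k)) \<in> H.spanned monomial_basis"
proof (rule H.spanned.congr)
  show "\<kappa> (inverse q ^ j) * (x ^ i * y ^ j * z ^ Suc k) \<in> H.spanned monomial_basis"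
    by (intro H.spanned.scale central_const monomial_spanned)
  have "x ^ i * (z * y ^ j) * z ^ k \<asymp> x ^ i * (\<kappa> (inverse q ^ j) * (y ^ j * z)) * z ^ k"
    by (intro H.congr_mult_right H.congr_mult_left z_y_power)
  then show "\<kappa> (inverse q ^ j) * (x ^ i * y ^ j * z ^ Suc k) \<asymp> x ^ i * (z * (y ^ j * z ^ k))"
    by (simp only: mult.assoc var_const_left_commute power_Suc H.congr_sym)
qed

lemma gen_mult_monomial_spanned: "free_var v * (x ^ i * y ^ j * z ^ k) \<in> H.spanned monomial_basis"
proof (cases v)
  case Gx
  then show ?thesis
    using monomial_spanned[of "Suc i" j k] by (simp add: mult.assoc)
next
  case Gy
  show ?thesis
  proof (cases i)
    case 0
    then show ?thesis
      using Gy monomial_spanned[of 0 "Suc j" k] by (simp add: mult.assoc)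
  next
    case (Suc l)
    have "(y * x ^ Suc l) * (y ^ j * z ^ k) \<asymp>
        (\<kappa> (q ^ Suc l) * (x ^ Suc l * y) + \<kappa> (of_nat (Suc l) * q ^ l) * (x ^ l * z)) * (y ^ j * z ^ k)"
      by (rule H.congr_mult_right[OF y_x_power])
    then have "y * (x ^ i * y ^ j * z ^ k) \<asymp> \<kappa> (q ^ Suc l) * (x ^ Suc l * y ^ Suc j * z ^ k) +
        \<kappa> (of_nat (Suc l) * q ^ l) * (x ^ l * (z * (y ^ j * z ^ k)))"
      by (simp only: Suc distrib_right mult.assoc power_Suc)
    moreover have "\<kappa> (q ^ Suc l) * (x ^ Suc l * y ^ Suc j * z ^ k) +
        \<kappa> (of_nat (Suc l) * q ^ l) * (x ^ l * (z * (y ^ j * z ^ k))) \<in> H.spanned monomial_basis"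
      by (intro H.spanned.add H.spanned.scale central_const monomial_spanned z_monomial_spanned)
    ultimately show ?thesis
      using Gy by (blast intro: H.spanned.congr H.congr_sym)
  qed
next
  case Gz
  have "(z * x ^ i) * (y ^ j * z ^ k) \<asymp> \<kappa> (q ^ i) * (x ^ i * z) * (y ^ j * z ^ k)"
    by (rule H.congr_mult_right[OF z_x_power])
  then have "z * (x ^ i * y ^ j * z ^ k) \<asymp> \<kappa> (q ^ i) * (x ^ i * (z * (y ^ j * z ^ k)))"
    by (simp only: mult.assoc)
  moreover have "\<kappa> (q ^ i) * (x ^ i * (z * (y ^ j * z ^ k))) \<in> H.spanned monomial_basis"
    by (intro H.spanned.scale central_const z_monomial_spanned)
  ultimately show ?thesis
    using Gz by (blast intro: H.spanned.congr H.congr_sym)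
qed

lemma gen_mult_spanned: "a \<in> H.spanned monomial_basis \<Longrightarrow> free_var v * a \<in> H.spanned monomial_basis"
proof (induction rule: H.spanned.induct)
  case (base b)
  then show ?case using gen_mult_monomial_spanned by (auto simp: monomial_basis_def)
next
  case (add a b)
  then show ?case by (simp add: distrib_left H.spanned.add)
next
  case (scale c a)
  have "c * free_var v * a \<asymp> free_var v * c * a"
    by (rule H.congr_mult_right[OF H.centralD[OF scale(1)]])
  then show ?case
    using H.spanned.congr[OF H.spanned.scale[OF scale(1,3)]] by (simp add: mult.assoc)
next
  case (congr a b)
  then show ?case by (blast intro: H.spanned.congr H.congr_mult_left)
qed

lemma mult_spanned: "b \<in> H.spanned monomial_basis \<Longrightarrow> a * b \<in> H.spanned monomial_basis"
proof (induction a arbitrary: b rule: free_alg_gen_induct)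
  case (const c)
  then show ?case by (rule H.spanned.scale[OF central_const])
next
  case (var v)
  then show ?case by (rule gen_mult_spanned)
next
  case (add a a')
  then show ?case by (simp add: distrib_right H.spanned.add)
next
  case (mult a a')
  then show ?case by (simp add: mult.assoc)
qed

lemma spanned_monomial_basis: "H.spanned monomial_basis = UNIV"
proof -
  have "a \<in> H.spanned monomial_basis" for a
    \<comment> \<open>The span is closed under left multiplication and contains \<open>1\<close>,
      the monomial with zero exponents.\<close>
    using mult_spanned[OF monomial_spanned[of 0 0 0], of a] by simp
  then show ?thesis by blast
qed

lemma standard_poly_identity: "poly_value r (standard_poly (Suc (card monomial_basis))) \<in> Hq_ideal q"
  by (rule H.standard_poly_mem_if_spanned[OF _ _ spanned_monomial_basis]) (simp_all add: monomial_basis_def)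

end

end

theorem proposition9p1:
  fixes q :: "'k::field"
  assumes "q \<noteq> 0" and "q \<noteq> 1" and "\<exists>n::nat. n > 0 \<and> q ^ n = 1"
  shows "PI_ring (Hq q) \<longleftrightarrow> CHAR('k) > 0"
proof -
  obtain n where n: "n > 0" "q ^ n = 1" using assms(3) by blast
  have PI: "PI_ring (Hq q) \<longleftrightarrow> (\<exists>f. monic_free f \<and> (\<forall>s. poly_value s f \<in> Hq_ideal q))"
    unfolding Hq_def Let_def by (rule PI_ring_quotient_iff[OF refl ideal_Hq_ideal])
  show ?thesis
  proof
    assume "PI_ring (Hq q)"
    then show "CHAR('k) > 0"
      using PI not_poly_value_in_ideal[OF _ n assms(1)] by blast
  next
    assume "CHAR('k) > 0"
    moreover have "q ^ (n * CHAR('k)) = 1"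
      using n(2) by (simp add: power_mult)
    ultimately show "PI_ring (Hq q)"
      \<comment> \<open>The factor \<open>n\<close> of this exponent gives \<open>q ^ N = 1\<close>,
        the factor \<open>CHAR('k)\<close> makes \<open>N\<close> vanish in the field.\<close>
      unfolding PI using n(1) monic_standard_poly standard_poly_identity[OF _ assms(1), of "n * CHAR('k)"]
      by (metis mult_pos_pos of_nat_CHAR of_nat_mult mult_zero_right)
  qed
qed

end
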